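(* Let $g\in W^{1,1}(\mathbb{R})$ be even with $\int_{\mathbb{R}} g=1$. Consider the system $$v^+_t+(\bar u+\bar a)\,v^+_x=0,\qquad v^-_t+(\bar u-\bar a)\,v^-_x=0,\qquad \bar u=g*u,\quad \bar a=g*a .$$ (i) If initially $v^-$ is constant and $v^+$ has a single jump discontinuity, $v^+(x,0)=v^+_l$ for $x<0$ and $v^+(x,0)=v^+_r$ for $x\ge 0$, then the discontinuity travels with speed $$s=\frac{u_l+u_r}{2}+\frac{a_l+a_r}{2}.$$ (ii) If initially $v^+$ is constant and $v^-$ has a single jump discontinuity, $v^-(x,0)=v^-_l$ for $x<0$ and $v^-(x,0)=v^-_r$ for $x\ge 0$, then the discontinuity travels with speed $$s=\frac{u_l+u_r}{2}-\frac{a_l+a_r}{2}.$$ Here $u_l,u_r,a_l,a_r$ are the limiting values of $u$ and $a$ on the left and right sides of the discontinuity, respectively.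
   Context: Here $x\in\mathbb{R}$, $t\ge 0$, $u$ is the fluid velocity, $a$ the speed of sound, $\gamma>0$, $\gamma\neq 1$ a fixed real constant, and $v^{\pm}=u\pm\frac{2a}{\gamma-1}$, so $u=\frac{v^++v^-}{2}$ and $a=\frac{\gamma-1}{4}(v^+-v^-)$. The convolution is in the space variable: $(g*f)(x,t)=\int_{\mathbb{R}} g(x-y)f(y,t)\,dy$. Sense of solution: for bounded initial data $v^\pm_0$, the solution is given by $v^\pm(x,t)=v_0^\pm(\varphi^\pm(x,t))$, where for each $t$ the map $x\mapsto\varphi^\pm(x,t)$ is the continuously differentiable inverse of $\xi\mapsto\phi^\pm(\xi,t)$, and $\frac{\partial}{\partial t}\phi^\pm(\xi,t)=\bar u(\phi^\pm(\xi,t),t)\pm\bar a(\phi^\pm(\xi,t),t)$, $\phi^\pm(\xi,0)=\xi$. Thus a discontinuity of $v^\pm_0$ at $x=0$ is located at time $t$ at $x^\pm(t)=\phi^\pm(0,t)$, and its speed is $\frac{d}{dt}x^\pm(t)$. *)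

theory Defs
  imports "HOL-Analysis.Analysis"
begin

definition test_function :: "(real \<Rightarrow> real) \<Rightarrow> bool" where
  "test_function p \<longleftrightarrow>
     (\<forall>n. (deriv ^^ n) p differentiable_on UNIV) \<and> compact (closure {x. p x \<noteq> 0})"

definition weak_derivative :: "(real \<Rightarrow> real) \<Rightarrow> (real \<Rightarrow> real) \<Rightarrow> bool" where
  "weak_derivative g h \<longleftrightarrow>
     (\<forall>p. test_function p \<longrightarrow>
        (LINT x|lebesgue. g x * deriv p x) = - (LINT x|lebesgue. h x * p x))"

(* Elements of the Sobolev space are represented by functions, not by classes modulo
   null sets; properties such as evenness should therefore be required almost everywhere. *)
definition sobolev_W11 :: "(real \<Rightarrow> real) set" where
  "sobolev_W11 = {g. integrable lebesgue g \<and> (\<exists>h. integrable lebesgue h \<and> weak_derivative g h)}"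

definition space_convolution ::
  "(real \<Rightarrow> real) \<Rightarrow> (real \<Rightarrow> real \<Rightarrow> real) \<Rightarrow> real \<Rightarrow> real \<Rightarrow> real" where
  "space_convolution g f x t = (LINT y|lebesgue. g (x - y) * f y t)"

definition velocity ::
  "(real \<Rightarrow> real \<Rightarrow> real) \<Rightarrow> (real \<Rightarrow> real \<Rightarrow> real) \<Rightarrow> real \<Rightarrow> real \<Rightarrow> real" where
  "velocity vp vm x t = (vp x t + vm x t) / 2"

definition sound_speed ::
  "real \<Rightarrow> (real \<Rightarrow> real \<Rightarrow> real) \<Rightarrow> (real \<Rightarrow> real \<Rightarrow> real) \<Rightarrow> real \<Rightarrow> real \<Rightarrow> real" where
  "sound_speed \<gamma> vp vm x t = (\<gamma> - 1) / 4 * (vp x t - vm x t)"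

(* All functions are written with arguments (space, time); only times t >= 0 matter.
   The derivative in t at t = 0 is one-sided. *)
definition characteristic_flow ::
  "(real \<Rightarrow> real \<Rightarrow> real) \<Rightarrow> (real \<Rightarrow> real \<Rightarrow> real) \<Rightarrow> bool" where
  "characteristic_flow w \<phi> \<longleftrightarrow>
     (\<forall>\<xi>. \<phi> \<xi> 0 = \<xi>) \<and>
     (\<forall>\<xi>. \<forall>t\<ge>0. ((\<lambda>\<tau>. \<phi> \<xi> \<tau>) has_real_derivative w (\<phi> \<xi> t) t) (at t within {0..}))"

definition transported ::
  "(real \<Rightarrow> real) \<Rightarrow> (real \<Rightarrow> real \<Rightarrow> real) \<Rightarrow> (real \<Rightarrow> real \<Rightarrow> real) \<Rightarrow> bool" where
  "transported v0 \<phi> v \<longleftrightarrow>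
     (\<exists>\<psi>. \<forall>t\<ge>0.
        (\<forall>\<xi>. \<psi> (\<phi> \<xi> t) t = \<xi>) \<and> (\<forall>x. \<phi> (\<psi> x t) t = x) \<and>
        (\<lambda>x. \<psi> x t) C1_differentiable_on UNIV \<and>
        (\<forall>x. v x t = v0 (\<psi> x t)))"

(* vp, vm are the Riemann variables, php, phm the characteristic flows along which they are
   constant. Bounded data are taken Borel measurable, so that the convolutions (of an
   integrable g) are genuine Lebesgue integrals. *)
definition regularized_solution ::
  "(real \<Rightarrow> real) \<Rightarrow> real \<Rightarrow> (real \<Rightarrow> real) \<Rightarrow> (real \<Rightarrow> real) \<Rightarrow>
   (real \<Rightarrow> real \<Rightarrow> real) \<Rightarrow> (real \<Rightarrow> real \<Rightarrow> real) \<Rightarrow>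
   (real \<Rightarrow> real \<Rightarrow> real) \<Rightarrow> (real \<Rightarrow> real \<Rightarrow> real) \<Rightarrow> bool" where
  "regularized_solution g \<gamma> v0p v0m vp vm php phm \<longleftrightarrow>
     v0p \<in> borel_measurable borel \<and> bounded (range v0p) \<and>
     v0m \<in> borel_measurable borel \<and> bounded (range v0m) \<and>
     characteristic_flow
       (\<lambda>x t. space_convolution g (velocity vp vm) x t
            + space_convolution g (sound_speed \<gamma> vp vm) x t) php \<and>
     characteristic_flow
       (\<lambda>x t. space_convolution g (velocity vp vm) x t
            - space_convolution g (sound_speed \<gamma> vp vm) x t) phm \<and>
     transported v0p php vp \<and> transported v0m phm vm"

definition jump_data :: "real \<Rightarrow> real \<Rightarrow> real \<Rightarrow> real" where
  "jump_data l r x = (if x < 0 then l else r)"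

definition has_side_limits :: "(real \<Rightarrow> real) \<Rightarrow> real \<Rightarrow> real \<Rightarrow> real \<Rightarrow> bool" where
  "has_side_limits f x l r \<longleftrightarrow> (f \<longlongrightarrow> l) (at_left x) \<and> (f \<longlongrightarrow> r) (at_right x)"

end

(* Distinct characteristics never meet and depend continuously on time, so they keep their initial
   order; hence the transported datum is a step function with its jump on the characteristic from 0.
   By evenness, the convolution of g with a step function, evaluated at the jump, is the mean of the
   two values. *)
theory Submission
  imports Defs
begin

text \<open>The affine substitution has Jacobian of modulus 1, so the density factor is 1. The
  setting is the completed measure \<open>lebesgue\<close>, because the kernel is only known to be
  Lebesgue measurable.\<close>

lemma lebesgue_integral_reflect:
  fixes f :: "real \<Rightarrow> real"
  assumes "f \<in> borel_measurable lebesgue"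
  shows "(LINT y|lebesgue. f (X - y)) = (LINT y|lebesgue. f y)"
proof -
  have meas: "(\<lambda>y. X + (-1) * y) \<in> lebesgue \<rightarrow>\<^sub>M lebesgue"
    using lebesgue_affine_measurable[of "\<lambda>_. -1::real" X] by simp
  have "(LINT y|lebesgue. f y) =
      (LINT y|density (distr lebesgue lebesgue (\<lambda>y. X + (-1) * y)) (\<lambda>_. ennreal \<bar>-1\<bar>). f y)"
    by (rule arg_cong[OF lebesgue_real_affine, where f="\<lambda>M. integral\<^sup>L M f"]) simp
  also have "\<dots> = (LINT y|distr lebesgue lebesgue (\<lambda>y. X + (-1) * y). f y)"
    by (simp add: density_1)
  also have "\<dots> = (LINT y|lebesgue. f (X + (-1) * y))"
    by (rule integral_distr[OF meas assms])
  finally show ?thesis by simp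
qed

lemma integrable_mult_step:
  fixes g :: "real \<Rightarrow> real"
  assumes "integrable lebesgue g" "S \<in> sets lebesgue"
  shows "integrable lebesgue (\<lambda>z. g z * (if z \<in> S then l else r))"
proof -
  have "integrable lebesgue (\<lambda>z. r * g z + (l - r) * (indicator S z *\<^sub>R g z))"
    by (intro Bochner_Integration.integrable_add integrable_mult_right integrable_mult_indicator assms)
  also have "(\<lambda>z. r * g z + (l - r) * (indicator S z *\<^sub>R g z)) =
      (\<lambda>z. g z * (if z \<in> S then l else r))"
    by (auto simp: fun_eq_iff indicator_def algebra_simps)
  finally show ?thesis .
qed

text \<open>Substituting z = \<open>X t\<close> - y moves the jump to the origin, and reflecting z
  then swaps the two values without changing the integral. The two versions add up to
  (\<open>l\<close> + \<open>r\<close>) times the mass of \<open>g\<close>, so each is half of that.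
  The location \<open>X\<close> depends on time so that a moving jump can be inserted
  directly.\<close>

lemma even_convolution_step:
  fixes g :: "real \<Rightarrow> real"
  assumes int: "integrable lebesgue g"
    and even: "AE x in lebesgue. g (- x) = g x"
    and one: "(LINT x|lebesgue. g x) = 1"
  shows "space_convolution g (\<lambda>y t. if y < X t then l else r) (X t) t = (l + r) / 2"
proof -
  \<comment> \<open>Since y < \<open>X t\<close> means z > 0, the left value \<open>l\<close> sits
    on the positive half-line in \<open>?p\<close>; \<open>?q\<close> is the mirror image.\<close>
  let ?p = "\<lambda>z. g z * (if z \<in> {0<..} then l else r)"
  let ?q = "\<lambda>z. g z * (if z \<in> {..<0} then l else r)"
  have ip: "integrable lebesgue ?p" and iq: "integrable lebesgue ?q"
    by (intro integrable_mult_step int; simp)+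
  have "space_convolution g (\<lambda>y t. if y < X t then l else r) (X t) t = (LINT y|lebesgue. ?p (X t - y))"
    by (simp add: space_convolution_def)
  also have "\<dots> = (LINT z|lebesgue. ?p z)"
    by (rule lebesgue_integral_reflect[OF borel_measurable_integrable[OF ip]])
  finally have 1: "space_convolution g (\<lambda>y t. if y < X t then l else r) (X t) t = (LINT z|lebesgue. ?p z)" .
  \<comment> \<open>Composition with an arbitrary Borel map can destroy Lebesgue measurability; a
    nondegenerate affine map such as the reflection preserves it.\<close>
  have mr: "(\<lambda>y. f (- y)) \<in> borel_measurable lebesgue"
    if "f \<in> borel_measurable lebesgue" for f :: "real \<Rightarrow> real"
    using measurable_compose[OF lebesgue_affine_measurable[of "\<lambda>_. -1::real" 0] that] by simp
  have "(LINT z|lebesgue. ?p z) = (LINT z|lebesgue. ?p (0 - z))"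
    by (rule lebesgue_integral_reflect[OF borel_measurable_integrable[OF ip], symmetric])
  also have "\<dots> = (LINT z|lebesgue. ?q z)"
  proof (rule integral_cong_AE)
    show "(\<lambda>z. ?p (0 - z)) \<in> borel_measurable lebesgue"
      using mr[OF borel_measurable_integrable[OF ip]] by simp
    show "?q \<in> borel_measurable lebesgue" by (rule borel_measurable_integrable[OF iq])
    show "AE z in lebesgue. ?p (0 - z) = ?q z"
      using even by eventually_elim auto
  qed
  finally have 2: "(LINT z|lebesgue. ?p z) = (LINT z|lebesgue. ?q z)" .
  have "(LINT z|lebesgue. ?p z) + (LINT z|lebesgue. ?q z) = (LINT z|lebesgue. ?p z + ?q z)"
    using ip iq by simp
  also have "\<dots> = (LINT z|lebesgue. (l + r) * g z)"
  proof (rule integral_cong_AE)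
    \<comment> \<open>At z = 0 both integrands take the value \<open>r\<close>, so the pointwise
      identity can fail there; this point is a null set.\<close>
    have "AE z in lebesgue. z \<noteq> (0::real)"
      by (rule AE_I'[of "{0}"]) auto
    then show "AE z in lebesgue. ?p z + ?q z = (l + r) * g z"
      by eventually_elim (auto simp: algebra_simps)
  qed (use ip iq int in auto)
  also have "\<dots> = l + r" by (simp add: one)
  finally show ?thesis using 1 2 by simp
qed

text \<open>Injectivity at each time comes from the spatial inverse in \<open>transported\<close>,
  not from a uniqueness theorem for the differential equation. Were the order lost at time
  \<open>t\<close>, the continuous difference of the two paths, positive at time 0, would vanish at
  some earlier time or at \<open>t\<close>, and the inverse there would identify the two starting
  points.\<close>

lemma characteristics_keep_order:
  assumes flow: "characteristic_flow w \<phi>" and tr: "transported v0 \<phi> v"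
    and "\<xi> < \<eta>" "0 \<le> t"
  shows "\<phi> \<xi> t < \<phi> \<eta> t"
proof (rule ccontr)
  assume "\<not> \<phi> \<xi> t < \<phi> \<eta> t"
  moreover have "continuous_on {0..t} (\<phi> \<zeta>)" for \<zeta>
  proof (rule continuous_on_subset)
    show "continuous_on {0..} (\<phi> \<zeta>)"
      using flow unfolding characteristic_flow_def
      by (intro DERIV_continuous_on[of _ _ "\<lambda>s. w (\<phi> \<zeta> s) s"]) auto
  qed auto
  then have "continuous_on {0..t} (\<lambda>s. \<phi> \<eta> s - \<phi> \<xi> s)"
    by (intro continuous_intros)
  moreover have "\<phi> \<eta> 0 - \<phi> \<xi> 0 \<ge> 0"
    using flow \<open>\<xi> < \<eta>\<close> by (simp add: characteristic_flow_def)
  ultimately obtain s where "0 \<le> s" "\<phi> \<eta> s - \<phi> \<xi> s = 0"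
    using IVT2'[of "\<lambda>s. \<phi> \<eta> s - \<phi> \<xi> s" t 0 0] \<open>0 \<le> t\<close> by auto
  then have "\<xi> = \<eta>"
    using tr unfolding transported_def by (metis eq_iff_diff_eq_0)
  with \<open>\<xi> < \<eta>\<close> show False by simp
qed

text \<open>The value at \<open>x\<close> is the datum at its starting point
  \<open>\<psi> x t\<close>, which is negative exactly when \<open>x\<close> lies left of the path
  from 0. On that path the starting point is 0, where \<open>jump_data\<close> takes the right
  value.\<close>

lemma transported_jump_data:
  assumes flow: "characteristic_flow w \<phi>" and tr: "transported (jump_data l r) \<phi> v" and "0 \<le> t"
  shows "v x t = (if x < \<phi> 0 t then l else r)"
proof -
  from tr \<open>0 \<le> t\<close> obtain \<psi> where inv: "\<phi> (\<psi> x t) t = x" and v: "v x t = jump_data l r (\<psi> x t)"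
    unfolding transported_def by blast
  \<comment> \<open>Trichotomy for the starting point: order preservation settles the negative and
    positive cases, and a zero starting point gives \<open>x = \<phi> 0 t\<close>.\<close>
  have "\<psi> x t < 0 \<longleftrightarrow> x < \<phi> 0 t"
    using characteristics_keep_order[OF flow tr, of "\<psi> x t" 0 t]
      characteristics_keep_order[OF flow tr, of 0 "\<psi> x t" t] inv \<open>0 \<le> t\<close>
    by (metis less_asym less_irrefl linorder_less_linear)
  then show ?thesis by (simp add: v jump_data_def)
qed

lemma transported_const:
  assumes "transported (\<lambda>x. c) \<phi> v" "0 \<le> t"
  shows "v x t = c"
  using assms unfolding transported_def by blast

lemma has_side_limits_step:
  "has_side_limits (\<lambda>x. if x < X then l else r) X l r"
  unfolding has_side_limits_def
  by (auto intro!: tendsto_eventually simp: eventually_at_filter)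

text \<open>Common core of both cases: \<open>\<epsilon>\<close> is 1 for the plus family and -1 for
  the minus family. The side values are constant in time, so they can be chosen before
  \<open>t\<close>.\<close>

lemma jump_speed:
  assumes "integrable lebesgue g" "AE x in lebesgue. g (- x) = g x" "(LINT x|lebesgue. g x) = 1"
    and flow: "characteristic_flow
      (\<lambda>x t. space_convolution g u x t + \<epsilon> * space_convolution g a x t) \<phi>"
    and u: "\<And>x t. 0 \<le> t \<Longrightarrow> u x t = (if x < \<phi> 0 t then ul else ur)"
    and a: "\<And>x t. 0 \<le> t \<Longrightarrow> a x t = (if x < \<phi> 0 t then al else ar)"
  shows "\<exists>ul ur al ar. \<forall>t\<ge>0. has_side_limits (\<lambda>x. u x t) (\<phi> 0 t) ul ur \<and>
    has_side_limits (\<lambda>x. a x t) (\<phi> 0 t) al ar \<and>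
    (\<phi> 0 has_real_derivative (ul + ur) / 2 + \<epsilon> * ((al + ar) / 2)) (at t within {0..})"
proof (intro exI allI impI conjI)
  fix t :: real assume "0 \<le> t"
  show "has_side_limits (\<lambda>x. u x t) (\<phi> 0 t) ul ur" "has_side_limits (\<lambda>x. a x t) (\<phi> 0 t) al ar"
    unfolding u[OF \<open>0 \<le> t\<close>] a[OF \<open>0 \<le> t\<close>] by (rule has_side_limits_step)+
  \<comment> \<open>The convolution at time \<open>t\<close> sees only the profile at that time,
    which is a step located at \<open>X = \<phi> 0\<close>.\<close>
  have "space_convolution g u (\<phi> 0 t) t = (ul + ur) / 2"
    using even_convolution_step[OF assms(1-3), where X="\<phi> 0"]
    unfolding space_convolution_def u[OF \<open>0 \<le> t\<close>] .
  moreover have "space_convolution g a (\<phi> 0 t) t = (al + ar) / 2"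
    using even_convolution_step[OF assms(1-3), where X="\<phi> 0"]
    unfolding space_convolution_def a[OF \<open>0 \<le> t\<close>] .
  \<comment> \<open>The flow equation for starting point 0 evaluates the averaged field exactly at
    the jump, where both convolutions are now known.\<close>
  moreover have "(\<phi> 0 has_real_derivative
      space_convolution g u (\<phi> 0 t) t + \<epsilon> * space_convolution g a (\<phi> 0 t) t) (at t within {0..})"
    using flow \<open>0 \<le> t\<close> unfolding characteristic_flow_def by blast
  ultimately show "(\<phi> 0 has_real_derivative (ul + ur) / 2 + \<epsilon> * ((al + ar) / 2)) (at t within {0..})"
    by metis
qed

theorem mainTheorem3:
  fixes g :: "real \<Rightarrow> real" and \<gamma> :: real
  assumes "g \<in> sobolev_W11"
    and "AE x in lebesgue. g (- x) = g x"
    and "(LINT x|lebesgue. g x) = 1"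
    and "\<gamma> > 0" and "\<gamma> \<noteq> 1"
  shows "(\<forall>vl vr c vp vm php phm.
      vl \<noteq> vr \<longrightarrow>
      regularized_solution g \<gamma> (jump_data vl vr) (\<lambda>x. c) vp vm php phm \<longrightarrow>
      (\<exists>ul ur al ar. \<forall>t\<ge>0.
         has_side_limits (\<lambda>x. velocity vp vm x t) (php 0 t) ul ur \<and>
         has_side_limits (\<lambda>x. sound_speed \<gamma> vp vm x t) (php 0 t) al ar \<and>
         ((\<lambda>\<tau>. php 0 \<tau>) has_real_derivative (ul + ur) / 2 + (al + ar) / 2)
            (at t within {0..})))
    \<and> (\<forall>vl vr c vp vm php phm.
      vl \<noteq> vr \<longrightarrow>
      regularized_solution g \<gamma> (\<lambda>x. c) (jump_data vl vr) vp vm php phm \<longrightarrow>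
      (\<exists>ul ur al ar. \<forall>t\<ge>0.
         has_side_limits (\<lambda>x. velocity vp vm x t) (phm 0 t) ul ur \<and>
         has_side_limits (\<lambda>x. sound_speed \<gamma> vp vm x t) (phm 0 t) al ar \<and>
         ((\<lambda>\<tau>. phm 0 \<tau>) has_real_derivative (ul + ur) / 2 - (al + ar) / 2)
            (at t within {0..})))"
proof (intro conjI allI impI)
  have g: "integrable lebesgue g" using assms(1) by (simp add: sobolev_W11_def)
  fix vl vr c vp vm php phm
  {
    assume "regularized_solution g \<gamma> (jump_data vl vr) (\<lambda>x. c) vp vm php phm"
    \<comment> \<open>The factor 1 is written out to match \<open>\<epsilon>\<close> in
      \<open>jump_speed\<close>.\<close>
    then have flow: "characteristic_flow
          (\<lambda>x t. space_convolution g (velocity vp vm) x t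
            + 1 * space_convolution g (sound_speed \<gamma> vp vm) x t) php"
      and vp: "transported (jump_data vl vr) php vp" and vm: "transported (\<lambda>x. c) phm vm"
      by (simp_all add: regularized_solution_def)
    \<comment> \<open>With \<open>vm\<close> frozen at \<open>c\<close>, both \<open>u\<close> and
      \<open>a\<close> inherit the jump of \<open>vp\<close> on the same path.\<close>
    have u: "velocity vp vm x t = (if x < php 0 t then (vl + c) / 2 else (vr + c) / 2)"
      and a: "sound_speed \<gamma> vp vm x t =
        (if x < php 0 t then (\<gamma> - 1) / 4 * (vl - c) else (\<gamma> - 1) / 4 * (vr - c))"
      if "0 \<le> t" for x t
      by (simp_all add: velocity_def sound_speed_def transported_jump_data[OF flow vp that]
          transported_const[OF vm that])
    show "\<exists>ul ur al ar. \<forall>t\<ge>0.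
         has_side_limits (\<lambda>x. velocity vp vm x t) (php 0 t) ul ur \<and>
         has_side_limits (\<lambda>x. sound_speed \<gamma> vp vm x t) (php 0 t) al ar \<and>
         ((\<lambda>\<tau>. php 0 \<tau>) has_real_derivative (ul + ur) / 2 + (al + ar) / 2) (at t within {0..})"
      using jump_speed[OF g assms(2,3) flow u a] unfolding mult_1 .
  }
  {
    assume "regularized_solution g \<gamma> (\<lambda>x. c) (jump_data vl vr) vp vm php phm"
    \<comment> \<open>The difference of the convolutions is read as a sum with
      \<open>\<epsilon>\<close> = -1; the final unfolding turns the resulting speed back into a
      difference.\<close>
    then have flow: "characteristic_flow
          (\<lambda>x t. space_convolution g (velocity vp vm) x t
            + (- 1) * space_convolution g (sound_speed \<gamma> vp vm) x t) phm"
      and vp: "transported (\<lambda>x. c) php vp" and vm: "transported (jump_data vl vr) phm vm"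
      by (simp_all add: regularized_solution_def)
    have u: "velocity vp vm x t = (if x < phm 0 t then (c + vl) / 2 else (c + vr) / 2)"
      and a: "sound_speed \<gamma> vp vm x t =
        (if x < phm 0 t then (\<gamma> - 1) / 4 * (c - vl) else (\<gamma> - 1) / 4 * (c - vr))"
      if "0 \<le> t" for x t
      by (simp_all add: velocity_def sound_speed_def transported_jump_data[OF flow vm that]
          transported_const[OF vp that])
    show "\<exists>ul ur al ar. \<forall>t\<ge>0.
         has_side_limits (\<lambda>x. velocity vp vm x t) (phm 0 t) ul ur \<and>
         has_side_limits (\<lambda>x. sound_speed \<gamma> vp vm x t) (phm 0 t) al ar \<and>
         ((\<lambda>\<tau>. phm 0 \<tau>) has_real_derivative (ul + ur) / 2 - (al + ar) / 2) (at t within {0..})"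
      using jump_speed[OF g assms(2,3) flow u a] unfolding mult_minus1 add_uminus_conv_diff .
  }
qed

end
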